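(* Every system of weakly-guarded contractions $\{X_i\succeq E_i\}_{i\in I}$ (with no restriction on the use of sums) has a unique solution for rooted bisimilarity: if $\tilde P$ and $\tilde Q$ satisfy $P_i\succeq^c_{\mathrm{bis}}E_i[\tilde P]$ and $Q_i\succeq^c_{\mathrm{bis}}E_i[\tilde Q]$ for all $i\in I$, then $P_i\approx^c Q_i$ for all $i\in I$ (and hence also $P_i\approx Q_i$).
   Context: CCS processes over names $\mathscr L$ (actions $\mu ::= \tau\mid a\mid\overline a$): $P ::= \mathbf 0 \mid \mu.P \mid P_1|P_2 \mid P_1+P_2 \mid (\nu a)P \mid A \mid \mathrm{rec}\,A.\,P \mid P[rf]$, with the standard SOS semantics. $\Rightarrow^{\epsilon}$ is the reflexive–transitive closure of $\xrightarrow{\tau}$; $P\Rightarrow^{\mu}P'$ means $P\Rightarrow^{\epsilon}\xrightarrow{\mu}\Rightarrow^{\epsilon}P'$; $P\,\widehat{\Rightarrow^{\mu}}\,P'$ means $P\Rightarrow^{\mu}P'$ or ($\mu=\tau$ and $P=P'$); $P\,\widehat{\xrightarrow{\mu}}\,P'$ means $P\xrightarrow{\mu}P'$ or ($\mu=\tau$, $P=P'$). Weak bisimilarity $\approx$: largest relation such that whenever $P\approx Q$, $P\xrightarrow{\mu}P'$ implies $Q\,\widehat{\Rightarrow^{\mu}}\,Q'$ with $P'\approx Q'$, and symmetrically. Rooted bisimilarity: $P\approx^c Q$ iff $P\xrightarrow{\mu}P'$ implies $Q\Rightarrow^{\mu}Q'$ with $P'\approx Q'$, and $Q\xrightarrow{\mu}Q'$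 implies $P\Rightarrow^{\mu}P'$ with $P'\approx Q'$. Bisimilarity contraction $\succeq_{\mathrm{bis}}$: $P\succeq_{\mathrm{bis}}Q$ iff $P\mathcal R Q$ for some relation $\mathcal R$ such that whenever $P\mathcal RQ$: $P\xrightarrow{\mu}P'$ implies $Q\,\widehat{\xrightarrow{\mu}}\,Q'$ with $P'\mathcal RQ'$, and $Q\xrightarrow{\mu}Q'$ implies $P\,\widehat{\Rightarrow^{\mu}}\,P'$ with $P'\approx Q'$. Rooted contraction: $P\succeq^c_{\mathrm{bis}}Q$ iff $P\xrightarrow{\mu}P'$ implies $Q\xrightarrow{\mu}Q'$ with $P'\succeq_{\mathrm{bis}}Q'$, and $Q\xrightarrow{\mu}Q'$ implies $P\Rightarrow^{\mu}P'$ with $P'\approx Q'$. A system of contractions $\{X_i\succeq E_i\}_{i\in I}$ ($I$ countable) consists of CCS expressions $E_i$ possibly containing variables $X_j$; $E[\tilde P]$ is syntactic replacement of each $X_j$ by $P_j$. It is weakly guarded if in each $E_i$ every occurrence of a variable lies underneath a prefix $\mu.\,$. *)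

theory Defs
  imports Main "HOL-Library.Countable_Set"
begin

section \<open>Syntax\<close>

datatype 'a label = Name 'a | Coname 'a

datatype 'a action = Tau | Vis "'a label"

primrec complement :: "'a label \<Rightarrow> 'a label" where
  "complement (Name a) = Coname a"
| "complement (Coname a) = Name a"

text \<open>
  A relabelling function acts on labels, commutes with complementation and fixes \<open>\<tau>\<close>.
  Such a function is determined by its values on names, and any choice of these values is possible;
  so it is represented by a map from names to labels, which \<open>relabel\<close> extends to actions.
\<close>

primrec relabel_label :: "('a \<Rightarrow> 'a label) \<Rightarrow> 'a label \<Rightarrow> 'a label" where
  "relabel_label rf (Name a) = rf a"
| "relabel_label rf (Coname a) = complement (rf a)"

primrec relabel :: "('a \<Rightarrow> 'a label) \<Rightarrow> 'a action \<Rightarrow> 'a action" where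
  "relabel rf Tau = Tau"
| "relabel rf (Vis l) = Vis (relabel_label rf l)"

text \<open>
  Expressions over names \<open>'a\<close> and equation variables indexed by \<open>'i\<close>. Agent variables
  \<open>A\<close>, bound by \<open>rec A. P\<close>, are de Bruijn indices: \<open>Agent n\<close> refers to the \<open>n\<close>-th
  enclosing \<open>Rec\<close>, and is a free agent variable if there are at most \<open>n\<close> of these.
  Processes are the expressions without equation variables.
\<close>

datatype (dead 'a, eqvars: 'i) ccs =
    EqVar 'i
  | Null
  | Prefix "'a action" "('a, 'i) ccs"
  | Par "('a, 'i) ccs" "('a, 'i) ccs"
  | Sum "('a, 'i) ccs" "('a, 'i) ccs"
  | Res 'a "('a, 'i) ccs"
  | Agent nat
  | Rec "('a, 'i) ccs"
  | Relab "('a, 'i) ccs" "'a \<Rightarrow> 'a label"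

definition process :: "('a, 'i) ccs \<Rightarrow> bool" where
  "process P \<longleftrightarrow> eqvars P = {}"

primrec lift :: "nat \<Rightarrow> ('a, 'i) ccs \<Rightarrow> ('a, 'i) ccs" where
  "lift k (EqVar i) = EqVar i"
| "lift k Null = Null"
| "lift k (Prefix \<mu> E) = Prefix \<mu> (lift k E)"
| "lift k (Par E F) = Par (lift k E) (lift k F)"
| "lift k (Sum E F) = Sum (lift k E) (lift k F)"
| "lift k (Res a E) = Res a (lift k E)"
| "lift k (Agent n) = (if n < k then Agent n else Agent (Suc n))"
| "lift k (Rec E) = Rec (lift (Suc k) E)"
| "lift k (Relab E rf) = Relab (lift k E) rf"

text \<open>
  \<open>agent_subst k G E\<close> is \<open>E{G/A}\<close>, with \<open>A\<close> the agent variable of index \<open>k\<close>, whose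
  binder is removed.
\<close>

primrec agent_subst :: "nat \<Rightarrow> ('a, 'i) ccs \<Rightarrow> ('a, 'i) ccs \<Rightarrow> ('a, 'i) ccs" where
  "agent_subst k G (EqVar i) = EqVar i"
| "agent_subst k G Null = Null"
| "agent_subst k G (Prefix \<mu> E) = Prefix \<mu> (agent_subst k G E)"
| "agent_subst k G (Par E F) = Par (agent_subst k G E) (agent_subst k G F)"
| "agent_subst k G (Sum E F) = Sum (agent_subst k G E) (agent_subst k G F)"
| "agent_subst k G (Res a E) = Res a (agent_subst k G E)"
| "agent_subst k G (Agent n) =
     (if n < k then Agent n else if n = k then G else Agent (n - 1))"
| "agent_subst k G (Rec E) = Rec (agent_subst (Suc k) (lift 0 G) E)"
| "agent_subst k G (Relab E rf) = Relab (agent_subst k G E) rf"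

text \<open>
  \<open>inst P E\<close> is \<open>E[P]\<close>. Under \<open>Rec\<close> the replacing processes are lifted, so that their
  free agent variables are not captured; on processes without free agent variables lifting is
  the identity.
\<close>

primrec inst :: "('i \<Rightarrow> ('a, 'i) ccs) \<Rightarrow> ('a, 'i) ccs \<Rightarrow> ('a, 'i) ccs" where
  "inst P (EqVar i) = P i"
| "inst P Null = Null"
| "inst P (Prefix \<mu> E) = Prefix \<mu> (inst P E)"
| "inst P (Par E F) = Par (inst P E) (inst P F)"
| "inst P (Sum E F) = Sum (inst P E) (inst P F)"
| "inst P (Res a E) = Res a (inst P E)"
| "inst P (Agent n) = Agent n"
| "inst P (Rec E) = Rec (inst (\<lambda>i. lift 0 (P i)) E)"
| "inst P (Relab E rf) = Relab (inst P E) rf"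

primrec weakly_guarded :: "('a, 'i) ccs \<Rightarrow> bool" where
  "weakly_guarded (EqVar i) \<longleftrightarrow> False"
| "weakly_guarded Null \<longleftrightarrow> True"
| "weakly_guarded (Prefix \<mu> E) \<longleftrightarrow> True"
| "weakly_guarded (Par E F) \<longleftrightarrow> weakly_guarded E \<and> weakly_guarded F"
| "weakly_guarded (Sum E F) \<longleftrightarrow> weakly_guarded E \<and> weakly_guarded F"
| "weakly_guarded (Res a E) \<longleftrightarrow> weakly_guarded E"
| "weakly_guarded (Agent n) \<longleftrightarrow> True"
| "weakly_guarded (Rec E) \<longleftrightarrow> weakly_guarded E"
| "weakly_guarded (Relab E rf) \<longleftrightarrow> weakly_guarded E"


section \<open>Operational semantics\<close>

inductive transition :: "('a, 'i) ccs \<Rightarrow> 'a action \<Rightarrow> ('a, 'i) ccs \<Rightarrow> bool" where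
  Prefix: "transition (Prefix \<mu> P) \<mu> P"
| SumL: "transition P \<mu> P' \<Longrightarrow> transition (Sum P Q) \<mu> P'"
| SumR: "transition Q \<mu> Q' \<Longrightarrow> transition (Sum P Q) \<mu> Q'"
| ParL: "transition P \<mu> P' \<Longrightarrow> transition (Par P Q) \<mu> (Par P' Q)"
| ParR: "transition Q \<mu> Q' \<Longrightarrow> transition (Par P Q) \<mu> (Par P Q')"
| Com: "transition P (Vis l) P' \<Longrightarrow> transition Q (Vis (complement l)) Q' \<Longrightarrow> transition (Par P Q) Tau (Par P' Q')"
| Res: "transition P \<mu> P' \<Longrightarrow> \<mu> \<noteq> Vis (Name a) \<Longrightarrow> \<mu> \<noteq> Vis (Coname a) \<Longrightarrow>
    transition (Res a P) \<mu> (Res a P')"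
| Rec: "transition (agent_subst 0 (Rec P) P) \<mu> P' \<Longrightarrow> transition (Rec P) \<mu> P'"
| Relab: "transition P \<mu> P' \<Longrightarrow> transition (Relab P rf) (relabel rf \<mu>) (Relab P' rf)"

definition eps_trans :: "('a, 'i) ccs \<Rightarrow> ('a, 'i) ccs \<Rightarrow> bool" where
  "eps_trans = (\<lambda>P Q. transition P Tau Q)\<^sup>*\<^sup>*"

definition weak_trans :: "('a, 'i) ccs \<Rightarrow> 'a action \<Rightarrow> ('a, 'i) ccs \<Rightarrow> bool" where
  "weak_trans P \<mu> P' \<longleftrightarrow> (\<exists>P1 P2. eps_trans P P1 \<and> transition P1 \<mu> P2 \<and> eps_trans P2 P')"

definition weak_trans_hat :: "('a, 'i) ccs \<Rightarrow> 'a action \<Rightarrow> ('a, 'i) ccs \<Rightarrow> bool" where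
  "weak_trans_hat P \<mu> P' \<longleftrightarrow> weak_trans P \<mu> P' \<or> (\<mu> = Tau \<and> P = P')"

definition trans_hat :: "('a, 'i) ccs \<Rightarrow> 'a action \<Rightarrow> ('a, 'i) ccs \<Rightarrow> bool" where
  "trans_hat P \<mu> P' \<longleftrightarrow> transition P \<mu> P' \<or> (\<mu> = Tau \<and> P = P')"


section \<open>Behavioural relations\<close>

definition weak_bisimulation :: "(('a, 'i) ccs \<Rightarrow> ('a, 'i) ccs \<Rightarrow> bool) \<Rightarrow> bool" where
  "weak_bisimulation R \<longleftrightarrow> (\<forall>P Q. R P Q \<longrightarrow>
     (\<forall>\<mu> P'. transition P \<mu> P' \<longrightarrow> (\<exists>Q'. weak_trans_hat Q \<mu> Q' \<and> R P' Q')) \<and>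
     (\<forall>\<mu> Q'. transition Q \<mu> Q' \<longrightarrow> (\<exists>P'. weak_trans_hat P \<mu> P' \<and> R P' Q')))"

definition weak_bisimilar :: "('a, 'i) ccs \<Rightarrow> ('a, 'i) ccs \<Rightarrow> bool"  (infix "\<approx>" 50) where
  "P \<approx> Q \<longleftrightarrow> (\<exists>R. weak_bisimulation R \<and> R P Q)"

definition rooted_bisimilar :: "('a, 'i) ccs \<Rightarrow> ('a, 'i) ccs \<Rightarrow> bool"  (infix "\<approx>\<^sup>c" 50) where
  "P \<approx>\<^sup>c Q \<longleftrightarrow>
     (\<forall>\<mu> P'. transition P \<mu> P' \<longrightarrow> (\<exists>Q'. weak_trans Q \<mu> Q' \<and> P' \<approx> Q')) \<and>
     (\<forall>\<mu> Q'. transition Q \<mu> Q' \<longrightarrow> (\<exists>P'. weak_trans P \<mu> P' \<and> P' \<approx> Q'))"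

definition bisim_contraction :: "(('a, 'i) ccs \<Rightarrow> ('a, 'i) ccs \<Rightarrow> bool) \<Rightarrow> bool" where
  "bisim_contraction R \<longleftrightarrow> (\<forall>P Q. R P Q \<longrightarrow>
     (\<forall>\<mu> P'. transition P \<mu> P' \<longrightarrow> (\<exists>Q'. trans_hat Q \<mu> Q' \<and> R P' Q')) \<and>
     (\<forall>\<mu> Q'. transition Q \<mu> Q' \<longrightarrow> (\<exists>P'. weak_trans_hat P \<mu> P' \<and> P' \<approx> Q')))"

definition contracts :: "('a, 'i) ccs \<Rightarrow> ('a, 'i) ccs \<Rightarrow> bool"
    (infix "\<succeq>\<^sub>b\<^sub>i\<^sub>s" 50) where
  "P \<succeq>\<^sub>b\<^sub>i\<^sub>s Q \<longleftrightarrow> (\<exists>R. bisim_contraction R \<and> R P Q)"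

definition rooted_contracts :: "('a, 'i) ccs \<Rightarrow> ('a, 'i) ccs \<Rightarrow> bool"
    (infix "\<succeq>\<^sup>c\<^sub>b\<^sub>i\<^sub>s" 50) where
  "P \<succeq>\<^sup>c\<^sub>b\<^sub>i\<^sub>s Q \<longleftrightarrow>
     (\<forall>\<mu> P'. transition P \<mu> P' \<longrightarrow> (\<exists>Q'. transition Q \<mu> Q' \<and> P' \<succeq>\<^sub>b\<^sub>i\<^sub>s Q')) \<and>
     (\<forall>\<mu> Q'. transition Q \<mu> Q' \<longrightarrow> (\<exists>P'. weak_trans P \<mu> P' \<and> P' \<approx> Q'))"


section \<open>Systems of contractions\<close>

definition contraction_system :: "'i set \<Rightarrow> ('i \<Rightarrow> ('a, 'i) ccs) \<Rightarrow> bool" where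
  "contraction_system I E \<longleftrightarrow> countable I \<and> (\<forall>i\<in>I. eqvars (E i) \<subseteq> I)"

definition rooted_solution ::
    "'i set \<Rightarrow> ('i \<Rightarrow> ('a, 'i) ccs) \<Rightarrow> ('i \<Rightarrow> ('a, 'i) ccs) \<Rightarrow> bool" where
  "rooted_solution I E P \<longleftrightarrow>
     (\<forall>i\<in>I. process (P i)) \<and> (\<forall>i\<in>I. P i \<succeq>\<^sup>c\<^sub>b\<^sub>i\<^sub>s inst P (E i))"

end

theory Submission imports Defs begin

text \<open>
  For solutions \<open>P\<close> and \<open>Q\<close>, every step of \<open>P i\<close> is matched by a strong step of \<open>E i[P]\<close>, which by weak
  guardedness is a step of the open expression \<open>E i\<close>, hence available to \<open>E i[Q]\<close> and so, weakly, to
  \<open>Q i\<close>. A step of \<open>C[P]\<close> therefore leads to some \<open>A \<succeq> C'[P]\<close> while \<open>C[Q]\<close> weakly reaches some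
  \<open>B \<approx> C'[Q]\<close>; only static operators surround a derivative, so no congruence property for sums or
  recursion is required. Since a contraction answers a step by at most one strong step, this matching
  can be iterated along weak transitions, and the pairs \<open>(A, B)\<close> with \<open>A \<approx> C[P]\<close> and \<open>C[Q] \<approx> B\<close> form a
  weak bisimulation.
\<close>


section \<open>Weak transitions\<close>

lemma eps_trans_refl [simp]: "eps_trans P P"
  by (simp add: eps_trans_def)

lemma eps_trans_trans: "eps_trans P Q \<Longrightarrow> eps_trans Q T \<Longrightarrow> eps_trans P T"
  unfolding eps_trans_def by (rule rtranclp_trans)

lemma transition_imp_eps_trans: "transition P Tau Q \<Longrightarrow> eps_trans P Q"
  unfolding eps_trans_def by (rule r_into_rtranclp)

lemma eps_trans_cases:
  assumes "eps_trans P Q"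
  obtains (refl) "Q = P" | (step) P' where "transition P Tau P'" "eps_trans P' Q"
  using assms unfolding eps_trans_def by (metis converse_rtranclpE)

lemma transition_imp_weak_trans: "transition P \<mu> Q \<Longrightarrow> weak_trans P \<mu> Q"
  unfolding weak_trans_def using eps_trans_refl by blast

lemma weak_trans_mono:
  assumes "weak_trans P \<mu> P'" and "\<And>\<nu> T. transition P \<nu> T \<Longrightarrow> transition Q \<nu> T"
  shows "weak_trans Q \<mu> P'"
proof -
  obtain P1 P2 where "eps_trans P P1" and tail: "transition P1 \<mu> P2" "eps_trans P2 P'"
    using assms(1) unfolding weak_trans_def by blast
  from \<open>eps_trans P P1\<close> show ?thesis
  proof (cases rule: eps_trans_cases)
    case refl
    then show ?thesis
      unfolding weak_trans_def using tail assms(2) eps_trans_refl by blast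
  next
    case (step T)
    then have "eps_trans Q P1"
      using assms(2) transition_imp_eps_trans eps_trans_trans by blast
    then show ?thesis
      unfolding weak_trans_def using tail by blast
  qed
qed

lemma eps_trans_map:
  assumes "\<And>P P'. transition P Tau P' \<Longrightarrow> transition (f P) Tau (f P')" and "eps_trans P P'"
  shows "eps_trans (f P) (f P')"
  using assms(2) unfolding eps_trans_def
  by (induction rule: rtranclp_induct) (auto intro: assms(1) rtranclp.rtrancl_into_rtrancl)

lemma weak_trans_map:
  assumes "\<And>P P'. transition P Tau P' \<Longrightarrow> transition (f P) Tau (f P')"
    and "\<And>P P'. transition P \<mu> P' \<Longrightarrow> transition (f P) \<nu> (f P')"
    and "weak_trans P \<mu> P'"
  shows "weak_trans (f P) \<nu> (f P')"
  using assms(3) eps_trans_map[of f, OF assms(1)] assms(2) unfolding weak_trans_def by blast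

definition hat ::
    "('p \<Rightarrow> 'a action \<Rightarrow> 'p \<Rightarrow> bool) \<Rightarrow> 'p \<Rightarrow> 'a action \<Rightarrow> 'p \<Rightarrow> bool" where
  "hat M P \<mu> P' \<longleftrightarrow> M P \<mu> P' \<or> (\<mu> = Tau \<and> P = P')"

lemma hat_transition: "hat transition = trans_hat"
  by (intro ext) (simp add: hat_def trans_hat_def)

lemma hat_weak_trans: "hat weak_trans = weak_trans_hat"
  by (intro ext) (simp add: hat_def weak_trans_hat_def)

lemma hat_hat [simp]: "hat (hat M) = hat M"
  by (intro ext) (auto simp: hat_def)

lemma hat_trans_hat: "hat trans_hat = trans_hat"
  by (simp flip: hat_transition)

lemma hat_weak_trans_hat: "hat weak_trans_hat = weak_trans_hat"
  by (simp flip: hat_weak_trans)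

lemma weak_trans_imp_hat: "weak_trans P \<mu> Q \<Longrightarrow> weak_trans_hat P \<mu> Q"
  by (simp add: weak_trans_hat_def)

lemma trans_hat_imp_weak_trans_hat: "trans_hat P \<mu> Q \<Longrightarrow> weak_trans_hat P \<mu> Q"
  by (auto simp: trans_hat_def weak_trans_hat_def transition_imp_weak_trans)

lemma weak_trans_hat_iff_trans_hat:
  "weak_trans_hat P \<mu> P' \<longleftrightarrow> (\<exists>P1 P2. eps_trans P P1 \<and> trans_hat P1 \<mu> P2 \<and> eps_trans P2 P')"
    (is "_ \<longleftrightarrow> ?decomposed")
proof
  show "weak_trans_hat P \<mu> P' \<Longrightarrow> ?decomposed"
    unfolding weak_trans_hat_def weak_trans_def trans_hat_def using eps_trans_refl by blast
next
  assume ?decomposed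
  then obtain P1 P2 where "eps_trans P P1" "trans_hat P1 \<mu> P2" "eps_trans P2 P'"
    by blast
  then consider (proper) "weak_trans P \<mu> P'" | (silent) "\<mu> = Tau" "eps_trans P P'"
    unfolding trans_hat_def weak_trans_def using eps_trans_trans by blast
  then show "weak_trans_hat P \<mu> P'"
  proof cases
    case silent
    from \<open>eps_trans P P'\<close> show ?thesis
      by (cases rule: eps_trans_cases)
        (use \<open>\<mu> = Tau\<close> eps_trans_refl in \<open>unfold weak_trans_hat_def weak_trans_def, blast+\<close>)
  qed (rule weak_trans_imp_hat)
qed

lemma weak_trans_hat_Tau: "weak_trans_hat P Tau Q \<longleftrightarrow> eps_trans P Q"
proof
  show "weak_trans_hat P Tau Q \<Longrightarrow> eps_trans P Q"
    unfolding weak_trans_hat_def weak_trans_def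
    using eps_trans_refl eps_trans_trans transition_imp_eps_trans by blast
  show "eps_trans P Q \<Longrightarrow> weak_trans_hat P Tau Q"
    unfolding weak_trans_hat_iff_trans_hat trans_hat_def using eps_trans_refl by blast
qed

lemma weak_trans_hat_eps:
  "eps_trans P P1 \<Longrightarrow> weak_trans_hat P1 \<mu> P2 \<Longrightarrow> eps_trans P2 P' \<Longrightarrow> weak_trans_hat P \<mu> P'"
  unfolding weak_trans_hat_iff_trans_hat using eps_trans_trans by blast


section \<open>Progressions\<close>

definition progresses ::
    "('p \<Rightarrow> 'l \<Rightarrow> 'p \<Rightarrow> bool) \<Rightarrow> ('q \<Rightarrow> 'l \<Rightarrow> 'q \<Rightarrow> bool) \<Rightarrow>
      ('p \<Rightarrow> 'q \<Rightarrow> bool) \<Rightarrow> ('p \<Rightarrow> 'q \<Rightarrow> bool) \<Rightarrow> bool" where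
  "progresses L M R S \<longleftrightarrow>
     (\<forall>p q \<mu> p'. R p q \<longrightarrow> L p \<mu> p' \<longrightarrow> (\<exists>q'. M q \<mu> q' \<and> S p' q'))"

abbreviation simulation ::
    "('p \<Rightarrow> 'l \<Rightarrow> 'p \<Rightarrow> bool) \<Rightarrow> ('q \<Rightarrow> 'l \<Rightarrow> 'q \<Rightarrow> bool) \<Rightarrow> ('p \<Rightarrow> 'q \<Rightarrow> bool) \<Rightarrow> bool" where
  "simulation L M R \<equiv> progresses L M R R"

lemma progressesI:
  assumes "\<And>p q \<mu> p'. R p q \<Longrightarrow> L p \<mu> p' \<Longrightarrow> \<exists>q'. M q \<mu> q' \<and> S p' q'"
  shows "progresses L M R S"
  using assms unfolding progresses_def by blast

lemma progressesE:
  assumes "progresses L M R S" and "R p q" and "L p \<mu> p'"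
  obtains q' where "M q \<mu> q'" and "S p' q'"
  using assms unfolding progresses_def by blast

lemma progresses_mono:
  assumes "progresses L M R S"
    and "R' \<le> R" and "\<And>q \<mu> q'. M q \<mu> q' \<Longrightarrow> M' q \<mu> q'" and "S \<le> S'"
  shows "progresses L M' R' S'"
  using assms unfolding progresses_def by blast

lemma progresses_sup:
  "progresses L M R T \<Longrightarrow> progresses L M S T \<Longrightarrow> progresses L M (sup R S) T"
  unfolding progresses_def by blast

lemma progresses_relcompp:
  "progresses K L R R' \<Longrightarrow> progresses L M S S' \<Longrightarrow> progresses K M (R OO S) (R' OO S')"
  unfolding progresses_def by blast

lemma progresses_hat:
  "progresses L M R S \<Longrightarrow> R \<le> S \<Longrightarrow> progresses (hat L) (hat M) R S"
  unfolding progresses_def hat_def by blast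

lemma simulation_trans_hat:
  "simulation transition trans_hat R \<Longrightarrow> simulation trans_hat trans_hat R"
  using progresses_hat[of transition trans_hat R R] by (simp add: hat_transition hat_trans_hat)

lemma simulation_eps_trans:
  assumes "simulation transition weak_trans_hat R" and "R P Q" and "eps_trans P P'"
  obtains Q' where "eps_trans Q Q'" and "R P' Q'"
proof -
  from assms(3) have "\<exists>Q'. eps_trans Q Q' \<and> R P' Q'"
    unfolding eps_trans_def
  proof (induction rule: rtranclp_induct)
    case base
    then show ?case using assms(2) by blast
  next
    case (step P1 P2)
    then show ?case
      using assms(1) unfolding progresses_def
      by (metis eps_trans_def eps_trans_trans weak_trans_hat_Tau)
  qed
  then show thesis using that by blast
qed

lemma simulation_weak_trans_hat:
  assumes "simulation transition weak_trans_hat R"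
  shows "simulation weak_trans_hat weak_trans_hat R"
proof (rule progressesI)
  fix P Q \<mu> P'
  assume "R P Q" and "weak_trans_hat P \<mu> P'"
  then obtain P1 P2 where P: "eps_trans P P1" "trans_hat P1 \<mu> P2" "eps_trans P2 P'"
    unfolding weak_trans_hat_iff_trans_hat by blast
  have hat: "simulation trans_hat weak_trans_hat R"
    using progresses_hat[OF assms] by (simp add: hat_transition hat_weak_trans_hat)
  obtain Q1 where Q1: "eps_trans Q Q1" "R P1 Q1"
    using simulation_eps_trans[OF assms \<open>R P Q\<close> P(1)] .
  obtain Q2 where Q2: "weak_trans_hat Q1 \<mu> Q2" "R P2 Q2"
    using progressesE[OF hat Q1(2) P(2)] .
  obtain Q' where Q': "eps_trans Q2 Q'" "R P' Q'"
    using simulation_eps_trans[OF assms Q2(2) P(3)] .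
  show "\<exists>Q'. weak_trans_hat Q \<mu> Q' \<and> R P' Q'"
    using weak_trans_hat_eps[OF Q1(1) Q2(1) Q'(1)] Q'(2) by blast
qed


section \<open>Weak bisimilarity\<close>

lemma weak_bisimulation_iff_simulation:
  "weak_bisimulation R \<longleftrightarrow>
    simulation transition weak_trans_hat R \<and> simulation transition weak_trans_hat R\<inverse>\<inverse>"
  unfolding weak_bisimulation_def progresses_def conversep_iff by blast

lemma weak_bisimilar_sym: "P \<approx> Q \<Longrightarrow> Q \<approx> P"
  unfolding weak_bisimilar_def weak_bisimulation_iff_simulation
  by (metis conversep_conversep conversepI)

lemma conversep_weak_bisimilar [simp]: "(\<approx>)\<inverse>\<inverse> = (\<approx>)"
  using weak_bisimilar_sym by blast

lemma simulation_weak_bisimilar: "simulation transition weak_trans_hat (\<approx>)"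
  unfolding progresses_def weak_bisimilar_def weak_bisimulation_iff_simulation by metis

lemma weak_bisimulation_le_weak_bisimilar:
  assumes "weak_bisimulation R"
  shows "R \<le> (\<approx>)"
proof (rule predicate2I)
  show "P \<approx> Q" if "R P Q" for P Q
    unfolding weak_bisimilar_def using assms that by blast
qed

lemma weak_bisimilar_coinduct:
  fixes R :: "('a, 'i) ccs \<Rightarrow> ('a, 'i) ccs \<Rightarrow> bool"
  assumes "progresses transition weak_trans_hat R (sup R (\<approx>))"
    and "progresses transition weak_trans_hat R\<inverse>\<inverse> (sup R\<inverse>\<inverse> (\<approx>))"
  shows "R \<le> (\<approx>)"
proof -
  have "progresses transition weak_trans_hat (\<approx>) (sup S (\<approx>))" for S :: "('a, 'i) ccs \<Rightarrow> _"
    using simulation_weak_bisimilar by (rule progresses_mono) auto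
  with assms have "weak_bisimulation (sup R (\<approx>))"
    by (simp add: weak_bisimulation_iff_simulation converse_join progresses_sup)
  then have "sup R (\<approx>) \<le> (\<approx>)"
    by (rule weak_bisimulation_le_weak_bisimilar)
  then show ?thesis by simp
qed

lemma weak_bisimilar_refl [simp]:
  fixes P :: "('a, 'i) ccs"
  shows "P \<approx> P"
proof -
  have "(=) \<le> ((\<approx>) :: ('a, 'i) ccs \<Rightarrow> _)"
    by (rule weak_bisimulation_le_weak_bisimilar)
      (auto simp: weak_bisimulation_iff_simulation
        intro!: progressesI weak_trans_imp_hat transition_imp_weak_trans)
  then show ?thesis by blast
qed

lemma weak_bisimilar_OO_weak_bisimilar: "(\<approx>) OO (\<approx>) = (\<approx>)"
proof (rule antisym)
  have "simulation transition weak_trans_hat ((\<approx>) OO (\<approx>))"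
    using simulation_weak_bisimilar simulation_weak_trans_hat[OF simulation_weak_bisimilar]
    by (rule progresses_relcompp)
  then show "(\<approx>) OO (\<approx>) \<le> (\<approx>)"
    by (intro weak_bisimulation_le_weak_bisimilar)
      (simp add: weak_bisimulation_iff_simulation converse_relcompp)
  show "(\<approx>) \<le> (\<approx>) OO (\<approx>)"
    using weak_bisimilar_refl by blast
qed

lemma rooted_bisimilar_sym: "P \<approx>\<^sup>c Q \<Longrightarrow> Q \<approx>\<^sup>c P"
  unfolding rooted_bisimilar_def using weak_bisimilar_sym by meson

lemma conversep_rooted_bisimilar [simp]: "(\<approx>\<^sup>c)\<inverse>\<inverse> = (\<approx>\<^sup>c)"
  using rooted_bisimilar_sym by blast

lemma le_rooted_bisimilarI:
  assumes "progresses transition weak_trans R (\<approx>)"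
    and "progresses transition weak_trans R\<inverse>\<inverse> (\<approx>)"
  shows "R \<le> (\<approx>\<^sup>c)"
  using assms weak_bisimilar_sym
  unfolding progresses_def rooted_bisimilar_def le_fun_def le_bool_def conversep_iff by meson

lemma progresses_rooted_bisimilar: "progresses transition weak_trans (\<approx>\<^sup>c) (\<approx>)"
  unfolding progresses_def rooted_bisimilar_def by blast

lemma rooted_bisimilar_le_weak_bisimilar: "(\<approx>\<^sup>c) \<le> (\<approx>)"
proof -
  have "progresses transition weak_trans_hat (\<approx>\<^sup>c) (sup (\<approx>\<^sup>c) (\<approx>))"
    using progresses_rooted_bisimilar by (rule progresses_mono) (auto intro: weak_trans_imp_hat)
  then show ?thesis
    by (intro weak_bisimilar_coinduct) simp_all
qed


section \<open>Bisimilarity contraction\<close>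

lemma bisim_contraction_iff_progresses:
  "bisim_contraction R \<longleftrightarrow>
    simulation transition trans_hat R \<and> progresses transition weak_trans_hat R\<inverse>\<inverse> (\<approx>)"
  unfolding bisim_contraction_def progresses_def conversep_iff
  using weak_bisimilar_sym by meson

lemma contracts_le_weak_bisimilar: "(\<succeq>\<^sub>b\<^sub>i\<^sub>s) \<le> (\<approx>)"
proof (intro predicate2I)
  fix P Q :: "('a, 'i) ccs"
  assume "P \<succeq>\<^sub>b\<^sub>i\<^sub>s Q"
  then obtain R where forward: "simulation transition trans_hat R"
      and backward: "progresses transition weak_trans_hat R\<inverse>\<inverse> (\<approx>)" and "R P Q"
    unfolding contracts_def bisim_contraction_iff_progresses by blast
  have "R \<le> (\<approx>)"
  proof (rule weak_bisimilar_coinduct)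
    show "progresses transition weak_trans_hat R (sup R (\<approx>))"
      using forward by (rule progresses_mono) (auto intro: trans_hat_imp_weak_trans_hat)
    show "progresses transition weak_trans_hat R\<inverse>\<inverse> (sup R\<inverse>\<inverse> (\<approx>))"
      using backward by (rule progresses_mono) auto
  qed
  with \<open>R P Q\<close> show "P \<approx> Q" by blast
qed

lemma simulation_contracts: "simulation transition trans_hat (\<succeq>\<^sub>b\<^sub>i\<^sub>s)"
  unfolding progresses_def contracts_def bisim_contraction_iff_progresses by metis

lemma bisim_contraction_le_contracts:
  assumes "bisim_contraction R"
  shows "R \<le> (\<succeq>\<^sub>b\<^sub>i\<^sub>s)"
proof (rule predicate2I)
  show "P \<succeq>\<^sub>b\<^sub>i\<^sub>s Q" if "R P Q" for P Q
    unfolding contracts_def using assms that by blast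
qed

lemma contracts_coinduct:
  assumes "simulation transition trans_hat R" and "R \<le> (\<approx>)"
  shows "R \<le> (\<succeq>\<^sub>b\<^sub>i\<^sub>s)"
proof -
  have "R\<inverse>\<inverse> \<le> (\<approx>)"
    using conversep_mono[THEN iffD2, OF assms(2)] by simp
  with simulation_weak_bisimilar have "progresses transition weak_trans_hat R\<inverse>\<inverse> (\<approx>)"
    by (rule progresses_mono) simp_all
  with assms(1) have "bisim_contraction R"
    by (simp add: bisim_contraction_iff_progresses)
  then show ?thesis
    by (rule bisim_contraction_le_contracts)
qed

lemma contracts_refl [simp]: "P \<succeq>\<^sub>b\<^sub>i\<^sub>s P"
proof -
  have "(=) \<le> (\<succeq>\<^sub>b\<^sub>i\<^sub>s)"
    by (rule contracts_coinduct) (auto simp: progresses_def trans_hat_def)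
  then show ?thesis by blast
qed

lemma contracts_OO_contracts: "(\<succeq>\<^sub>b\<^sub>i\<^sub>s) OO (\<succeq>\<^sub>b\<^sub>i\<^sub>s) = (\<succeq>\<^sub>b\<^sub>i\<^sub>s)"
proof (rule antisym)
  have "simulation transition trans_hat ((\<succeq>\<^sub>b\<^sub>i\<^sub>s) OO (\<succeq>\<^sub>b\<^sub>i\<^sub>s))"
    using simulation_contracts simulation_trans_hat[OF simulation_contracts]
    by (rule progresses_relcompp)
  moreover have "(\<succeq>\<^sub>b\<^sub>i\<^sub>s) OO (\<succeq>\<^sub>b\<^sub>i\<^sub>s) \<le> (\<approx>)"
    using relcompp_mono[OF contracts_le_weak_bisimilar contracts_le_weak_bisimilar]
    by (simp add: weak_bisimilar_OO_weak_bisimilar)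
  ultimately show "(\<succeq>\<^sub>b\<^sub>i\<^sub>s) OO (\<succeq>\<^sub>b\<^sub>i\<^sub>s) \<le> (\<succeq>\<^sub>b\<^sub>i\<^sub>s)"
    by (rule contracts_coinduct)
  show "(\<succeq>\<^sub>b\<^sub>i\<^sub>s) \<le> (\<succeq>\<^sub>b\<^sub>i\<^sub>s) OO (\<succeq>\<^sub>b\<^sub>i\<^sub>s)"
    using contracts_refl by blast
qed

lemma weak_bisimilar_OO_contracts: "(\<approx>) OO (\<succeq>\<^sub>b\<^sub>i\<^sub>s) = (\<approx>)"
proof (rule antisym)
  show "(\<approx>) OO (\<succeq>\<^sub>b\<^sub>i\<^sub>s) \<le> (\<approx>)"
    using relcompp_mono[OF order_refl[of "(\<approx>)"] contracts_le_weak_bisimilar]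
    by (simp add: weak_bisimilar_OO_weak_bisimilar)
  show "(\<approx>) \<le> (\<approx>) OO (\<succeq>\<^sub>b\<^sub>i\<^sub>s)"
    using contracts_refl by blast
qed

lemma progresses_rooted_contracts: "progresses transition transition (\<succeq>\<^sup>c\<^sub>b\<^sub>i\<^sub>s) (\<succeq>\<^sub>b\<^sub>i\<^sub>s)"
  unfolding progresses_def rooted_contracts_def by blast

lemma progresses_conversep_rooted_contracts:
  "progresses transition weak_trans (\<succeq>\<^sup>c\<^sub>b\<^sub>i\<^sub>s)\<inverse>\<inverse> (\<approx>)"
  unfolding progresses_def rooted_contracts_def conversep_iff using weak_bisimilar_sym by blast


section \<open>Static operators\<close>

locale static_rules =
  fixes M :: "('a, 'i) ccs \<Rightarrow> 'a action \<Rightarrow> ('a, 'i) ccs \<Rightarrow> bool"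
  assumes Par_left: "M P \<mu> P' \<Longrightarrow> M (Par P Q) \<mu> (Par P' Q)"
    and Par_right: "M Q \<mu> Q' \<Longrightarrow> M (Par P Q) \<mu> (Par P Q')"
    and Par_sync: "M P (Vis l) P' \<Longrightarrow> M Q (Vis (complement l)) Q' \<Longrightarrow> M (Par P Q) Tau (Par P' Q')"
    and Res_cong: "M P \<mu> P' \<Longrightarrow> \<mu> \<noteq> Vis (Name a) \<Longrightarrow> \<mu> \<noteq> Vis (Coname a) \<Longrightarrow>
      M (Res a P) \<mu> (Res a P')"
    and Relab_cong: "M P \<mu> P' \<Longrightarrow> M (Relab P rf) (relabel rf \<mu>) (Relab P' rf)"

lemma static_rules_transition: "static_rules transition"
  by unfold_locales (rule transition.intros; assumption)+

lemma static_rules_hat: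
  assumes "static_rules M"
  shows "static_rules (hat M)"
proof -
  interpret static_rules M by fact
  show ?thesis
    by unfold_locales (auto simp: hat_def intro: Par_left Par_right Par_sync Res_cong Relab_cong)
qed

lemma eps_trans_Par:
  assumes "eps_trans P P'" and "eps_trans Q Q'"
  shows "eps_trans (Par P Q) (Par P' Q')"
proof (rule eps_trans_trans)
  show "eps_trans (Par P Q) (Par P' Q)"
    using transition.ParL assms(1) by (rule eps_trans_map)
  show "eps_trans (Par P' Q) (Par P' Q')"
    using transition.ParR assms(2) by (rule eps_trans_map)
qed

lemma static_rules_weak_trans: "static_rules weak_trans"
proof
  fix P P' Q Q' :: "('a, 'b) ccs" and \<mu> l a rf
  show "weak_trans P \<mu> P' \<Longrightarrow> weak_trans (Par P Q) \<mu> (Par P' Q)"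
    by (rule weak_trans_map[of "\<lambda>P. Par P Q"]) (auto intro: transition.ParL)
  show "weak_trans Q \<mu> Q' \<Longrightarrow> weak_trans (Par P Q) \<mu> (Par P Q')"
    by (rule weak_trans_map[of "Par P"]) (auto intro: transition.ParR)
  show "weak_trans P (Vis l) P' \<Longrightarrow> weak_trans Q (Vis (complement l)) Q' \<Longrightarrow>
      weak_trans (Par P Q) Tau (Par P' Q')"
    unfolding weak_trans_def using eps_trans_Par transition.Com by meson
  show "weak_trans P \<mu> P' \<Longrightarrow> \<mu> \<noteq> Vis (Name a) \<Longrightarrow> \<mu> \<noteq> Vis (Coname a) \<Longrightarrow>
      weak_trans (Res a P) \<mu> (Res a P')"
    by (rule weak_trans_map[of "Res a"]) (auto intro: transition.Res)
  show "weak_trans P \<mu> P' \<Longrightarrow> weak_trans (Relab P rf) (relabel rf \<mu>) (Relab P' rf)"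
    by (rule weak_trans_map[of "\<lambda>P. Relab P rf"])
      (use transition.Relab[of _ Tau _ rf] in \<open>auto intro: transition.Relab\<close>)
qed

inductive static_closure ::
    "(('a, 'i) ccs \<Rightarrow> ('a, 'i) ccs \<Rightarrow> bool) \<Rightarrow> ('a, 'i) ccs \<Rightarrow> ('a, 'i) ccs \<Rightarrow> bool" for R where
  base: "R P Q \<Longrightarrow> static_closure R P Q"
| Par: "static_closure R P1 Q1 \<Longrightarrow> static_closure R P2 Q2 \<Longrightarrow>
    static_closure R (Par P1 P2) (Par Q1 Q2)"
| Res: "static_closure R P Q \<Longrightarrow> static_closure R (Res a P) (Res a Q)"
| Relab: "static_closure R P Q \<Longrightarrow> static_closure R (Relab P rf) (Relab Q rf)"

lemma static_closure_le_intros: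
  assumes "static_closure R \<le> R"
  shows "R P1 Q1 \<Longrightarrow> R P2 Q2 \<Longrightarrow> R (Par P1 P2) (Par Q1 Q2)"
    and "R P Q \<Longrightarrow> R (Res a P) (Res a Q)"
    and "R P Q \<Longrightarrow> R (Relab P rf) (Relab Q rf)"
  by (rule predicate2D[OF assms], blast intro: static_closure.intros)+

lemma static_closure_mono: "R \<le> S \<Longrightarrow> static_closure R \<le> static_closure S"
proof (intro predicate2I)
  fix P Q
  assume "R \<le> S" and "static_closure R P Q"
  from this(2,1) show "static_closure S P Q"
    by induction (auto intro: static_closure.intros)
qed

lemma static_closure_relcompp: "static_closure (R OO S) \<le> static_closure R OO static_closure S"
proof (rule predicate2I)
  show "(static_closure R OO static_closure S) P Q" if "static_closure (R OO S) P Q" for P Q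
    using that by induction (blast intro: static_closure.intros)+
qed

lemma static_closure_conversep: "(static_closure R)\<inverse>\<inverse> = static_closure R\<inverse>\<inverse>"
proof -
  have "static_closure R Q P \<Longrightarrow> static_closure R\<inverse>\<inverse> P Q" for R and P Q :: "('a, 'b) ccs"
    by (induction rule: static_closure.induct) (auto intro: static_closure.intros)
  from this[of R] this[of "R\<inverse>\<inverse>"] show ?thesis
    by (intro ext) auto
qed

lemma (in static_rules) simulation_static_closure:
  assumes "simulation transition M R"
  shows "simulation transition M (static_closure R)"
proof (rule progressesI)
  fix P Q \<mu> P'
  assume "static_closure R P Q" and "transition P \<mu> P'"
  then show "\<exists>Q'. M Q \<mu> Q' \<and> static_closure R P' Q'"
  proof (induction arbitrary: \<mu> P' rule: static_closure.induct)
    case (base P Q)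
    with assms show ?case by (auto elim!: progressesE intro: static_closure.base)
  next
    case (Par P1 Q1 P2 Q2)
    from Par.prems show ?case
    proof cases
      case (ParL P1')
      with Par show ?thesis by (blast intro: Par_left static_closure.Par)
    next
      case (ParR P2')
      with Par show ?thesis by (blast intro: Par_right static_closure.Par)
    next
      case (Com l P1' P2')
      with Par show ?thesis by (blast intro: Par_sync static_closure.Par)
    qed
  next
    case (Res P Q a)
    from Res.prems show ?case
      by cases (use Res.IH in \<open>blast intro: Res_cong static_closure.Res\<close>)
  next
    case (Relab P Q rf)
    from Relab.prems show ?case
      by cases (use Relab.IH in \<open>blast intro: Relab_cong static_closure.Relab\<close>)
  qed
qed

lemma static_closure_weak_bisimilar: "static_closure (\<approx>) \<le> (\<approx>)"
proof -
  have "simulation transition weak_trans_hat (static_closure (\<approx>))"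
    using static_rules_hat[OF static_rules_weak_trans] simulation_weak_bisimilar
    unfolding hat_weak_trans by (rule static_rules.simulation_static_closure)
  then show ?thesis
    by (intro weak_bisimulation_le_weak_bisimilar)
      (simp add: weak_bisimulation_iff_simulation static_closure_conversep)
qed

lemma static_closure_contracts: "static_closure (\<succeq>\<^sub>b\<^sub>i\<^sub>s) \<le> (\<succeq>\<^sub>b\<^sub>i\<^sub>s)"
proof (rule contracts_coinduct)
  show "simulation transition trans_hat (static_closure (\<succeq>\<^sub>b\<^sub>i\<^sub>s))"
    using static_rules_hat[OF static_rules_transition] simulation_contracts
    unfolding hat_transition by (rule static_rules.simulation_static_closure)
  show "static_closure (\<succeq>\<^sub>b\<^sub>i\<^sub>s) \<le> (\<approx>)"
    using static_closure_mono[OF contracts_le_weak_bisimilar] static_closure_weak_bisimilar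
    by (rule order_trans)
qed


section \<open>Instantiation of equation variables\<close>

lemma lift_lift: "j \<le> k \<Longrightarrow> lift j (lift k E) = lift (Suc k) (lift j E)"
  by (induction E arbitrary: j k) auto

lemma agent_subst_lift [simp]: "agent_subst k G (lift k E) = E"
  by (induction E arbitrary: k G) auto

lemma inst_lift: "inst (\<lambda>i. lift k (P i)) (lift k E) = lift k (inst P E)"
proof (induction E arbitrary: k P)
  case (Rec E)
  show ?case using Rec[of "Suc k" "\<lambda>i. lift 0 (P i)"] by (simp add: lift_lift)
qed auto

lemma inst_agent_subst:
  "inst P (agent_subst k G E) = agent_subst k (inst P G) (inst (\<lambda>i. lift k (P i)) E)"
proof (induction E arbitrary: k G P)
  case (Rec E)
  show ?case
    using Rec[of "\<lambda>i. lift 0 (P i)" "Suc k" "lift 0 G"] by (simp add: lift_lift inst_lift)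
qed auto

lemma weakly_guarded_lift [simp]: "weakly_guarded (lift k E) \<longleftrightarrow> weakly_guarded E"
  by (induction E arbitrary: k) auto

lemma weakly_guarded_agent_subst:
  "weakly_guarded G \<Longrightarrow> weakly_guarded E \<Longrightarrow> weakly_guarded (agent_subst k G E)"
  by (induction E arbitrary: k G) auto

lemma eqvars_lift [simp]: "eqvars (lift k E) = eqvars E"
  by (induction E arbitrary: k) auto

lemma eqvars_agent_subst: "eqvars (agent_subst k G E) \<subseteq> eqvars G \<union> eqvars E"
proof (induction E arbitrary: k G)
  case (Rec E)
  show ?case using Rec[of "Suc k" "lift 0 G"] by simp
next
  case (Par E F)
  then show ?case by (simp, blast)
next
  case (Sum E F)
  then show ?case by (simp, blast)
qed simp_all

lemma eqvars_unfold_Rec: "eqvars (agent_subst 0 (Rec E) E) \<subseteq> eqvars E"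
  using eqvars_agent_subst[of 0 "Rec E" E] by simp

lemma eqvars_transition: "transition E \<mu> E' \<Longrightarrow> eqvars E' \<subseteq> eqvars E"
  by (induction rule: transition.induct) (auto dest: subsetD[OF eqvars_unfold_Rec])

lemma transition_inst: "transition E \<mu> E' \<Longrightarrow> transition (inst P E) \<mu> (inst P E')"
proof (induction rule: transition.induct)
  case (Rec E \<mu> E')
  then show ?case by (auto simp: inst_agent_subst intro: transition.Rec)
qed (auto intro: transition.intros)

lemma weak_trans_inst_Rec:
  "weak_trans (inst P (agent_subst 0 (Rec E) E)) \<mu> T \<Longrightarrow> weak_trans (inst P (Rec E)) \<mu> T"
  by (erule weak_trans_mono) (simp add: inst_agent_subst transition.Rec)

text \<open>
  The operational rules, read along the structure of the open expression: an induction over a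
  transition of \<open>inst P E\<close> meets the processes \<open>P i\<close> only in case \<open>EqVar\<close>.
\<close>

inductive inst_transition ::
    "('i \<Rightarrow> ('a, 'i) ccs) \<Rightarrow> ('a, 'i) ccs \<Rightarrow> 'a action \<Rightarrow> ('a, 'i) ccs \<Rightarrow> bool" for P where
  EqVar: "transition (P i) \<mu> T \<Longrightarrow> inst_transition P (EqVar i) \<mu> T"
| Prefix: "inst_transition P (Prefix \<mu> E) \<mu> (inst P E)"
| SumL: "inst_transition P E \<mu> T \<Longrightarrow> inst_transition P (Sum E F) \<mu> T"
| SumR: "inst_transition P F \<mu> T \<Longrightarrow> inst_transition P (Sum E F) \<mu> T"
| ParL: "inst_transition P E \<mu> T \<Longrightarrow> inst_transition P (Par E F) \<mu> (Par T (inst P F))"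
| ParR: "inst_transition P F \<mu> T \<Longrightarrow> inst_transition P (Par E F) \<mu> (Par (inst P E) T)"
| Com: "inst_transition P E (Vis l) T \<Longrightarrow> inst_transition P F (Vis (complement l)) U \<Longrightarrow>
    inst_transition P (Par E F) Tau (Par T U)"
| Res: "inst_transition P E \<mu> T \<Longrightarrow> \<mu> \<noteq> Vis (Name a) \<Longrightarrow> \<mu> \<noteq> Vis (Coname a) \<Longrightarrow>
    inst_transition P (Res a E) \<mu> (Res a T)"
| Rec: "inst_transition P (agent_subst 0 (Rec E) E) \<mu> T \<Longrightarrow> inst_transition P (Rec E) \<mu> T"
| Relab: "inst_transition P E \<mu> T \<Longrightarrow> inst_transition P (Relab E rf) (relabel rf \<mu>) (Relab T rf)"

lemma inst_transition_EqVar: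
  "X = P i \<Longrightarrow> transition X \<mu> T \<Longrightarrow> inst_transition P (EqVar i) \<mu> T"
  by (simp add: inst_transition.EqVar)

lemma transition_imp_inst_transition:
  "transition (inst P E) \<mu> T \<Longrightarrow> inst_transition P E \<mu> T"
proof (induction "inst P E" \<mu> T arbitrary: E rule: transition.induct)
  case (Rec X \<mu> T)
  from Rec.hyps(3) show ?case
  proof (cases E)
    case (Rec F)
    with Rec.hyps(3) have "agent_subst 0 (Rec X) X = inst P (agent_subst 0 (Rec F) F)"
      by (simp add: inst_agent_subst)
    with Rec Rec.hyps(2) show ?thesis by (blast intro: inst_transition.Rec)
  qed (auto intro: inst_transition_EqVar transition.Rec Rec.hyps(1))
next
  case (Prefix \<mu> X)
  then show ?case by (cases E) (auto intro: inst_transition_EqVar inst_transition.intros transition.intros)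
next
  case (SumL X \<mu> T Y)
  then show ?case by (cases E) (auto intro: inst_transition_EqVar inst_transition.intros transition.intros)
next
  case (SumR Y \<mu> T X)
  then show ?case by (cases E) (auto intro: inst_transition_EqVar inst_transition.intros transition.intros)
next
  case (ParL X \<mu> T Y)
  then show ?case by (cases E) (auto intro: inst_transition_EqVar inst_transition.intros transition.intros)
next
  case (ParR Y \<mu> T X)
  then show ?case by (cases E) (auto intro: inst_transition_EqVar inst_transition.intros transition.intros)
next
  case (Com X l T Y U)
  then show ?case by (cases E) (auto intro: inst_transition_EqVar inst_transition.intros transition.intros)
next
  case (Res X \<mu> T a)
  then show ?case by (cases E) (auto intro: inst_transition_EqVar inst_transition.intros transition.intros)
next
  case (Relab X \<mu> T rf)
  then show ?case by (cases E) (auto intro: inst_transition_EqVar inst_transition.intros transition.intros)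
qed

lemma inst_transition_weakly_guardedE:
  assumes "inst_transition P E \<mu> T" and "weakly_guarded E"
  obtains E' where "transition E \<mu> E'" and "T = inst P E'"
proof -
  have "\<exists>E'. transition E \<mu> E' \<and> T = inst P E'"
    using assms
  proof (induction rule: inst_transition.induct)
    case (Rec E \<mu> T)
    then show ?case by (auto simp: weakly_guarded_agent_subst intro: transition.Rec)
  qed (fastforce intro: transition.intros)+
  then show thesis using that by blast
qed


section \<open>Unique solution\<close>

inductive pointwise :: "'i set \<Rightarrow> ('i \<Rightarrow> 'p) \<Rightarrow> ('i \<Rightarrow> 'q) \<Rightarrow> 'p \<Rightarrow> 'q \<Rightarrow> bool" for I P Q where
  "i \<in> I \<Longrightarrow> pointwise I P Q (P i) (Q i)"

lemma conversep_pointwise: "(pointwise I P Q)\<inverse>\<inverse> = pointwise I Q P"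
  by (intro ext) (auto elim!: pointwise.cases intro: pointwise.intros)

inductive instances ::
    "'i set \<Rightarrow> ('i \<Rightarrow> ('a, 'i) ccs) \<Rightarrow> ('i \<Rightarrow> ('a, 'i) ccs) \<Rightarrow>
      ('a, 'i) ccs \<Rightarrow> ('a, 'i) ccs \<Rightarrow> bool" for I P Q where
  "eqvars C \<subseteq> I \<Longrightarrow> instances I P Q (inst P C) (inst Q C)"

lemma conversep_instances: "(instances I P Q)\<inverse>\<inverse> = instances I Q P"
  by (intro ext) (auto elim!: instances.cases intro: instances.intros)

lemma static_closure_instances: "static_closure (instances I P Q) \<le> instances I P Q"
proof (rule predicate2I)
  fix A B
  assume "static_closure (instances I P Q) A B"
  then have "\<exists>C. eqvars C \<subseteq> I \<and> A = inst P C \<and> B = inst Q C"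
  proof induction
    case (base A B)
    then show ?case by (auto elim: instances.cases)
  next
    case (Par A1 B1 A2 B2)
    then obtain C D where "eqvars C \<subseteq> I" "A1 = inst P C" "B1 = inst Q C"
        and "eqvars D \<subseteq> I" "A2 = inst P D" "B2 = inst Q D"
      by blast
    then show ?case by (intro exI[of _ "Par C D"]) simp
  next
    case (Res A B a)
    then obtain C where "eqvars C \<subseteq> I" "A = inst P C" "B = inst Q C" by blast
    then show ?case by (intro exI[of _ "Res a C"]) simp
  next
    case (Relab A B rf)
    then obtain C where "eqvars C \<subseteq> I" "A = inst P C" "B = inst Q C" by blast
    then show ?case by (intro exI[of _ "Relab C rf"]) simp
  qed
  then show "instances I P Q A B" by (auto intro: instances.intros)
qed

lemma inst_transition_matched:
  assumes static: "static_closure R \<le> R" and "instances I P Q \<le> R"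
    and "progresses transition weak_trans (pointwise I P Q) R"
    and "inst_transition P C \<mu> T" and "eqvars C \<subseteq> I"
  shows "\<exists>U. weak_trans (inst Q C) \<mu> U \<and> R T U"
proof -
  interpret weak_trans: static_rules weak_trans by (rule static_rules_weak_trans)
  note instances_in_R = predicate2D[OF assms(2) instances.intros]
    and static_intros = static_closure_le_intros[OF static]
  from assms(4,5) show ?thesis
  proof (induction rule: inst_transition.induct)
    case (EqVar i \<mu> T)
    with assms(3) show ?case by (auto elim!: progressesE intro: pointwise.intros)
  next
    case (Prefix \<mu> C)
    then show ?case
      by (auto intro!: exI[of _ "inst Q C"] instances_in_R transition_imp_weak_trans transition.Prefix)
  next
    case (ParL C \<mu> T D)
    then show ?case by (fastforce intro: weak_trans.Par_left static_intros instances_in_R)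
  next
    case (ParR D \<mu> T C)
    then show ?case by (fastforce intro: weak_trans.Par_right static_intros instances_in_R)
  next
    case (Com C l T D U)
    then show ?case by (fastforce intro: weak_trans.Par_sync static_intros)
  next
    case (Res C \<mu> T a)
    then show ?case by (fastforce intro: weak_trans.Res_cong static_intros)
  next
    case (Rec C \<mu> T)
    have "eqvars (agent_subst 0 (Rec C) C) \<subseteq> I"
      using Rec.prems eqvars_unfold_Rec[of C] by simp
    with Rec.IH show ?case by (blast intro: weak_trans_inst_Rec)
  next
    case (Relab C \<mu> T rf)
    then show ?case by (fastforce intro: weak_trans.Relab_cong static_intros)
  qed (auto intro: weak_trans_mono transition.SumL transition.SumR)
qed

lemma progresses_instances:
  assumes "static_closure R \<le> R" and "instances I P Q \<le> R"
    and "progresses transition weak_trans (pointwise I P Q) R"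
  shows "progresses transition weak_trans (instances I P Q) R"
proof (rule progressesI)
  fix A B \<mu> T
  assume "instances I P Q A B" and "transition A \<mu> T"
  then obtain C where "eqvars C \<subseteq> I" and "B = inst Q C" and "inst_transition P C \<mu> T"
    by (auto elim!: instances.cases dest: transition_imp_inst_transition)
  then show "\<exists>U. weak_trans B \<mu> U \<and> R T U"
    using inst_transition_matched[OF assms] by blast
qed

definition contracted_instances ::
    "'i set \<Rightarrow> ('i \<Rightarrow> ('a, 'i) ccs) \<Rightarrow> ('i \<Rightarrow> ('a, 'i) ccs) \<Rightarrow>
      ('a, 'i) ccs \<Rightarrow> ('a, 'i) ccs \<Rightarrow> bool" where
  "contracted_instances I P Q = (\<succeq>\<^sub>b\<^sub>i\<^sub>s) OO instances I P Q OO (\<approx>)"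

lemma instances_le_contracted_instances: "instances I P Q \<le> contracted_instances I P Q"
  unfolding contracted_instances_def using contracts_refl weak_bisimilar_refl by blast

lemma contracts_OO_contracted_instances_OO_weak_bisimilar:
  "(\<succeq>\<^sub>b\<^sub>i\<^sub>s) OO contracted_instances I P Q OO (\<approx>) = contracted_instances I P Q"
  unfolding contracted_instances_def
  by (metis relcompp_assoc contracts_OO_contracts weak_bisimilar_OO_weak_bisimilar)

lemma weak_bisimilar_OO_contracted_instances:
  "(\<approx>) OO contracted_instances I P Q = (\<approx>) OO instances I P Q OO (\<approx>)"
  unfolding contracted_instances_def by (metis relcompp_assoc weak_bisimilar_OO_contracts)

lemma static_closure_contracted_instances:
  "static_closure (contracted_instances I P Q) \<le> contracted_instances I P Q"
proof -
  have "static_closure (contracted_instances I P Q)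
      \<le> static_closure (\<succeq>\<^sub>b\<^sub>i\<^sub>s) OO static_closure (instances I P Q) OO static_closure (\<approx>)"
    unfolding contracted_instances_def
    by (rule order_trans[OF static_closure_relcompp
          relcompp_mono[OF order_refl static_closure_relcompp]])
  also have "\<dots> \<le> contracted_instances I P Q"
    unfolding contracted_instances_def
    by (intro relcompp_mono static_closure_contracts static_closure_instances static_closure_weak_bisimilar)
  finally show ?thesis .
qed

locale weakly_guarded_system =
  fixes I :: "'i set" and E :: "'i \<Rightarrow> ('a, 'i) ccs"
  assumes eqvars_E: "i \<in> I \<Longrightarrow> eqvars (E i) \<subseteq> I"
    and weakly_guarded_E: "i \<in> I \<Longrightarrow> weakly_guarded (E i)"
begin

lemma progresses_right_hand_sides:
  "progresses transition transition
    (pointwise I (\<lambda>i. inst P (E i)) (\<lambda>i. inst Q (E i))) (instances I P Q)"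
proof (rule progressesI)
  fix A B \<mu> A'
  assume "pointwise I (\<lambda>i. inst P (E i)) (\<lambda>i. inst Q (E i)) A B" and "transition A \<mu> A'"
  then obtain i where "i \<in> I" and B: "B = inst Q (E i)" and "inst_transition P (E i) \<mu> A'"
    by (auto elim!: pointwise.cases dest: transition_imp_inst_transition)
  then obtain C where open_step: "transition (E i) \<mu> C" and A': "A' = inst P C"
    using inst_transition_weakly_guardedE weakly_guarded_E by blast
  have "eqvars C \<subseteq> I"
    using eqvars_transition[OF open_step] eqvars_E[OF \<open>i \<in> I\<close>] by blast
  then have "instances I P Q A' (inst Q C)"
    unfolding A' by (rule instances.intros)
  moreover have "transition B \<mu> (inst Q C)"
    unfolding B using open_step by (rule transition_inst)
  ultimately show "\<exists>B'. transition B \<mu> B' \<and> instances I P Q A' B'"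
    by blast
qed

lemma progresses_solutions:
  assumes "rooted_solution I E P" and "rooted_solution I E Q"
  shows "progresses transition weak_trans (pointwise I P Q) (contracted_instances I P Q)"
proof -
  let ?right_hand_sides = "pointwise I (\<lambda>i. inst P (E i)) (\<lambda>i. inst Q (E i))"
  have "progresses transition weak_trans
      ((\<succeq>\<^sup>c\<^sub>b\<^sub>i\<^sub>s) OO ?right_hand_sides OO (\<succeq>\<^sup>c\<^sub>b\<^sub>i\<^sub>s)\<inverse>\<inverse>) (contracted_instances I P Q)"
    unfolding contracted_instances_def
    by (rule progresses_relcompp[OF progresses_rooted_contracts
          progresses_relcompp[OF progresses_right_hand_sides progresses_conversep_rooted_contracts]])
  moreover have "pointwise I P Q \<le> (\<succeq>\<^sup>c\<^sub>b\<^sub>i\<^sub>s) OO ?right_hand_sides OO (\<succeq>\<^sup>c\<^sub>b\<^sub>i\<^sub>s)\<inverse>\<inverse>"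
    using assms unfolding rooted_solution_def by (blast elim: pointwise.cases intro: pointwise.intros)
  ultimately show ?thesis
    by (rule progresses_mono) simp_all
qed

lemma simulation_contracted_instances:
  assumes "rooted_solution I E P" and "rooted_solution I E Q"
  shows "simulation transition weak_trans_hat (contracted_instances I P Q)"
proof -
  let ?R = "contracted_instances I P Q"
  have "progresses transition weak_trans (instances I P Q) ?R"
    using static_closure_contracted_instances instances_le_contracted_instances
      progresses_solutions[OF assms] by (rule progresses_instances)
  then have "progresses trans_hat weak_trans_hat (instances I P Q) ?R"
    using progresses_hat instances_le_contracted_instances
    unfolding hat_transition[symmetric] hat_weak_trans[symmetric] by blast
  then have "progresses transition weak_trans_hat
      ((\<succeq>\<^sub>b\<^sub>i\<^sub>s) OO instances I P Q OO (\<approx>)) ((\<succeq>\<^sub>b\<^sub>i\<^sub>s) OO ?R OO (\<approx>))"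
    by (intro progresses_relcompp[OF simulation_contracts] progresses_relcompp
          [OF _ simulation_weak_trans_hat[OF simulation_weak_bisimilar]])
  then show ?thesis
    unfolding contracts_OO_contracted_instances_OO_weak_bisimilar
    by (simp flip: contracted_instances_def)
qed

lemma instances_le_weak_bisimilar:
  assumes "rooted_solution I E P" and "rooted_solution I E Q"
  shows "instances I P Q \<le> (\<approx>)"
proof -
  have simulation: "simulation transition weak_trans_hat ((\<approx>) OO instances I P Q OO (\<approx>))"
    if "rooted_solution I E P" and "rooted_solution I E Q" for P Q
    using progresses_relcompp[OF simulation_weak_bisimilar
        simulation_weak_trans_hat[OF simulation_contracted_instances[OF that]]]
    by (simp add: weak_bisimilar_OO_contracted_instances)
  have "((\<approx>) OO instances I P Q OO (\<approx>))\<inverse>\<inverse> = (\<approx>) OO instances I Q P OO (\<approx>)"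
    by (simp add: converse_relcompp relcompp_assoc conversep_instances)
  then have "weak_bisimulation ((\<approx>) OO instances I P Q OO (\<approx>))"
    using simulation assms by (simp add: weak_bisimulation_iff_simulation)
  then have "(\<approx>) OO instances I P Q OO (\<approx>) \<le> (\<approx>)"
    by (rule weak_bisimulation_le_weak_bisimilar)
  then show ?thesis
    using weak_bisimilar_refl by blast
qed

lemma solutions_rooted_bisimilar:
  assumes "rooted_solution I E P" and "rooted_solution I E Q"
  shows "pointwise I P Q \<le> (\<approx>\<^sup>c)"
proof (rule le_rooted_bisimilarI)
  have "progresses transition weak_trans (pointwise I P Q) (\<approx>)"
    if "rooted_solution I E P" and "rooted_solution I E Q" for P Q
  proof -
    have "contracted_instances I P Q \<le> (\<approx>) OO (\<approx>) OO (\<approx>)"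
      unfolding contracted_instances_def
      by (intro relcompp_mono contracts_le_weak_bisimilar instances_le_weak_bisimilar that order_refl)
    then have "contracted_instances I P Q \<le> (\<approx>)"
      by (simp add: weak_bisimilar_OO_weak_bisimilar)
    with progresses_solutions[OF that] show ?thesis
      by (auto intro: progresses_mono)
  qed
  then show "progresses transition weak_trans (pointwise I P Q) (\<approx>)"
    and "progresses transition weak_trans (pointwise I P Q)\<inverse>\<inverse> (\<approx>)"
    using assms by (simp_all add: conversep_pointwise)
qed

end

theorem theorem3p13:
  fixes I :: "'i set" and E P Q :: "'i \<Rightarrow> ('a, 'i) ccs"
  assumes "contraction_system I E"
    and "\<forall>i\<in>I. weakly_guarded (E i)"
    and "rooted_solution I E P"
    and "rooted_solution I E Q"
  shows "(\<forall>i\<in>I. P i \<approx>\<^sup>c Q i) \<and> (\<forall>i\<in>I. P i \<approx> Q i)"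
proof -
  interpret weakly_guarded_system I E
    using assms(1,2) by unfold_locales (auto simp: contraction_system_def)
  have "\<forall>i\<in>I. P i \<approx>\<^sup>c Q i"
    by (blast intro: predicate2D[OF solutions_rooted_bisimilar[OF assms(3,4)]] pointwise.intros)
  then show ?thesis
    by (blast intro: predicate2D[OF rooted_bisimilar_le_weak_bisimilar])
qed

end
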